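(* Let $A=(A_0,A_1,A_2,A_3)$ be generic complex parameters. The middle convolution with parameter $-\frac12-A_2$ sends $\tilde Z(A)$ to the operator of order 3 $$Q(A)=mc_{-\frac12-A_2}(\tilde Z(A))=x^2(x-1)^2\partial^3+q_1(x)\partial^2+q_2(x)\partial+q_3(x),$$ where \begin{align*} q_1&=(2A_2+3)(x-1)x(2x-1),\\ q_2&=A_0^2x-A_0^2-A_1^2x+5A_2^2x^2-5A_2^2x+A_2^2+12A_2x^2-12A_2x+2A_2-A_3^2x^2+A_3^2x+7x^2-7x+1,\\ q_3&=\tfrac12(2A_2+1)\left(A_0^2-A_1^2+2A_2^2x-A_2^2+4A_2x-2A_2-2A_3^2x+A_3^2+2x-1\right). \end{align*} The Riemann scheme of $Q(A)$ is $$\left\{\begin{matrix} x=0&x=1&x=\infty \\ 0&0&1+2A_2 \\ -A_0-A_2&-A_1-A_2&1+A_2-A_3 \\ A_0-A_2&A_1-A_2&1+A_2+A_3 \end{matrix}\right\}.$$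
   Context: Let $\partial=d/dx$, $\theta=x\partial$. Middle convolution. For a differential operator $P=\sum p_{ij}x^i\partial^j$ with constant $p_{ij}$ and $\mu\in\mathbb{C}$, $mc_\mu P$ (symbolically $\partial^{-\mu}\circ P\circ\partial^{\mu}$) is defined as follows: put $r=\max\{i-j: p_{ij}\neq0\}$, multiply $P$ by $\partial^r$ from the left, use $x^i\partial^i=\theta(\theta-1)\cdots(\theta-i+1)$ to express $\partial^rP$ as a linear combination of $\theta^i\partial^j$, replace $\theta$ by $\theta-\mu$, and divide the result by $\partial$ from the left as many times as possible. The operator $\tilde Z(A)=x^2(x-1)^2\partial^4+m_1\partial^3+m_2\partial^2+m_3\partial+m_4$ has \begin{align*} m_1&=4(x-1)x(2x-1),\\ m_2&=\tfrac14\left(4A_0^2x-4A_0^2-4A_1^2x-4A_2^2x^2+4A_2^2x-4A_3^2x^2+4A_3^2x+58x^2-58x+9\right),\\ m_3&=\tfrac12\left(2A_0^2-2A_1^2-4A_2^2x+2A_2^2-4A_3^2x+2A_3^2+10x-5\right),\\ m_4&=(A_2-\tfrac12)(A_2+\tfrac12)(A_3-\tfrac12)(A_3+\tfrac12). \end{align*} The Riemann scheme is the table of local exponents at the singular points $0,1,\infty$ (at infinity, exponent $s$ means behaviour $x^{-s}$). Generic means outside a countable union of proper algebraic hypersurfaces of the parameter space. *)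

theory Defs
  imports
    Complex_Main
    "HOL-Library.Countable_Set"
    "HOL-Library.Multiset"
    "HOL-Computational_Algebra.Computational_Algebra"
begin

text \<open>
  A differential operator with polynomial coefficients, \<open>P = (\<Sum>i j. p i j * x^i * \<partial>^j)\<close>, is
  encoded by its normal form: \<open>coeff P j\<close> is the coefficient of \<open>\<partial>^j\<close>, a polynomial in \<open>x\<close>, so
  that \<open>p i j = coeff (coeff P j) i\<close> and \<open>degree P\<close> is the order.  The ring multiplication of
  \<open>complex poly poly\<close> is commutative and hence is not composition of operators.  Only left
  multiplications are needed: by a polynomial \<open>a\<close> in \<open>x\<close> this is \<open>smult a\<close>, by \<open>\<partial>\<close> it is
  \<open>lmul_d\<close>, where \<open>\<partial> a = a \<partial> + a'\<close> is used.
\<close>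

type_synonym diffop = "complex poly poly"

abbreviation X :: "complex poly" where "X \<equiv> [:0, 1:]"

definition supp :: "diffop \<Rightarrow> (nat \<times> nat) set" where
  "supp P = {(i, j). coeff (coeff P j) i \<noteq> 0}"

definition lmul_d :: "diffop \<Rightarrow> diffop" where
  "lmul_d P = pCons 0 P + map_poly pderiv P"

definition lmul_theta :: "diffop \<Rightarrow> diffop" where
  "lmul_theta P = smult X (lmul_d P)"

text \<open>The action on polynomials, which shows that \<open>lmul_d\<close> is composition with \<open>d/dx\<close>.\<close>

definition apply_op :: "diffop \<Rightarrow> complex poly \<Rightarrow> complex poly" where
  "apply_op P f = (\<Sum>j\<le>degree P. coeff P j * (pderiv ^^ j) f)"

lemma apply_op_altdef:
  assumes "degree P \<le> n"
  shows "apply_op P f = (\<Sum>j\<le>n. coeff P j * (pderiv ^^ j) f)"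
  unfolding apply_op_def using assms
  by (intro sum.mono_neutral_left) (auto simp: coeff_eq_0)

lemma apply_op_lmul_d: "apply_op (lmul_d P) f = pderiv (apply_op P f)"
proof -
  let ?n = "degree P"
  have c: "coeff (lmul_d P) j = (case j of 0 \<Rightarrow> 0 | Suc k \<Rightarrow> coeff P k) + pderiv (coeff P j)" for j
    by (simp add: lmul_d_def coeff_pCons coeff_map_poly split: nat.splits)
  have "degree (lmul_d P) \<le> Suc ?n"
    by (rule degree_le) (auto simp: c coeff_eq_0 split: nat.splits)
  then have "apply_op (lmul_d P) f = (\<Sum>j\<le>Suc ?n. coeff (lmul_d P) j * (pderiv ^^ j) f)"
    by (rule apply_op_altdef)
  also have "\<dots> = (\<Sum>j\<le>Suc ?n. (case j of 0 \<Rightarrow> 0 | Suc k \<Rightarrow> coeff P k) * (pderiv ^^ j) f)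
                 + (\<Sum>j\<le>Suc ?n. pderiv (coeff P j) * (pderiv ^^ j) f)"
    by (simp add: c algebra_simps sum.distrib)
  also have "\<dots> = (\<Sum>j\<le>?n. coeff P j * (pderiv ^^ Suc j) f)
                 + (\<Sum>j\<le>?n. pderiv (coeff P j) * (pderiv ^^ j) f)"
    by (subst sum.atMost_Suc_shift) (simp add: coeff_eq_0)
  also have "\<dots> = pderiv (apply_op P f)"
    unfolding apply_op_def
    by (subst higher_pderiv_sum[of 1, simplified])
       (simp add: pderiv_mult sum.distrib algebra_simps)
  finally show ?thesis .
qed

lemma apply_op_lmul_theta: "apply_op (lmul_theta P) f = X * pderiv (apply_op P f)"
proof -
  have "apply_op (smult X Q) f = X * apply_op Q f" for Q
    unfolding apply_op_def by (simp add: sum_distrib_left mult.assoc)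
  then show ?thesis by (simp only: lmul_theta_def apply_op_lmul_d)
qed

text \<open>
  \<open>\<theta>\<close>-forms: \<open>T :: complex poly poly\<close> stands for \<open>(\<Sum>j. T j(\<theta>) \<partial>^j)\<close>, where \<open>T j = coeff T j\<close>
  is a polynomial in \<open>\<theta>\<close>.  For \<open>i \<le> j\<close> one has \<open>x^i \<partial>^j = \<theta> (\<theta> - 1) \<dots> (\<theta> - i + 1) \<partial>^(j - i)\<close>;
  \<open>to_theta\<close> is meaningful only for operators all of whose monomials satisfy \<open>i \<le> j\<close>.
\<close>

definition falling :: "nat \<Rightarrow> complex poly" where
  "falling i = (\<Prod>m<i. [:- of_nat m, 1:])"

definition to_theta :: "diffop \<Rightarrow> complex poly poly" where
  "to_theta P = (\<Sum>(i, j)\<in>supp P. monom (smult (coeff (coeff P j) i) (falling i)) (j - i))"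

definition of_theta :: "complex poly poly \<Rightarrow> diffop" where
  "of_theta T = (\<Sum>j\<le>degree T. \<Sum>i\<le>degree (coeff T j).
     smult [:coeff (coeff T j) i:] ((lmul_theta ^^ i) (monom 1 j)))"

text \<open>The quotient after dividing by \<open>\<partial>\<close> from the left as many times as possible.\<close>

definition strip_d :: "diffop \<Rightarrow> diffop" where
  "strip_d P = (THE R. (\<exists>k. P = (lmul_d ^^ k) R) \<and> (\<nexists>S. R = lmul_d S))"

text \<open>
  If \<open>r < 0\<close>, no multiplication by \<open>\<partial>\<close> takes place: \<open>\<theta> \<mapsto> \<theta> - \<mu>\<close> commutes with left multiplication by
  \<open>\<partial>\<close>, so any surplus factor of \<open>\<partial>\<close> is removed by \<open>strip_d\<close> anyway.
\<close>

definition mc :: "complex \<Rightarrow> diffop \<Rightarrow> diffop" where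
  "mc \<mu> P =
    (let r = Max ((\<lambda>(i, j). int i - int j) ` supp P);
         T = to_theta ((lmul_d ^^ nat r) P)
     in strip_d (of_theta (map_poly (\<lambda>f. f \<circ>\<^sub>p [:-\<mu>, 1:]) T)))"

datatype point = Fin complex | Infty

text \<open>
  The operator in the local coordinate \<open>x - a\<close>, respectively \<open>w = 1/x\<close>.  In the latter case
  \<open>d/dx = - w^2 d/dw\<close>, and the operator is multiplied by \<open>w^N\<close>, with \<open>N\<close> the maximal degree of its
  coefficients, to make the coefficients polynomial;
  \<open>monom 1 (N - degree p) * reflect_poly p\<close> is \<open>w^N * p(1/w)\<close>.
\<close>

definition op_at_infinity :: "diffop \<Rightarrow> diffop" where
  "op_at_infinity P =
    (let N = Max ((\<lambda>j. degree (coeff P j)) ` {..degree P})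
     in \<Sum>j\<le>degree P. smult (monom 1 (N - degree (coeff P j)) * reflect_poly (coeff P j))
          (((\<lambda>L. smult (- (X ^ 2)) (lmul_d L)) ^^ j) 1))"

fun local_op :: "diffop \<Rightarrow> point \<Rightarrow> diffop" where
  "local_op P (Fin a) = map_poly (\<lambda>p. p \<circ>\<^sub>p [:a, 1:]) P"
| "local_op P Infty = op_at_infinity P"

text \<open>A singular point is one where some \<open>p\<^sub>j / p\<^sub>n\<close> (\<open>n\<close> the order) has a pole.\<close>

definition singular_point :: "diffop \<Rightarrow> point \<Rightarrow> bool" where
  "singular_point P pt \<longleftrightarrow> (let L = local_op P pt in
     \<exists>j<degree L. coeff L j \<noteq> 0 \<and> order 0 (coeff L j) < order 0 (lead_coeff L))"

text \<open>
  The indicial polynomial \<open>f\<close> at the origin: \<open>P t^s = f(s) t^(s + e) + (higher powers of t)\<close>,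
  where \<open>t^i (d/dt)^j t^s = s (s - 1) \<dots> (s - j + 1) t^(s + i - j)\<close>.  The origin is a regular
  singular (or regular) point iff \<open>f\<close> has degree equal to the order of \<open>P\<close>.
\<close>

definition indicial :: "diffop \<Rightarrow> complex poly" where
  "indicial P =
    (let e = Min ((\<lambda>(i, j). int i - int j) ` supp P)
     in \<Sum>(i, j)\<in>{(i, j)\<in>supp P. int i - int j = e}. smult (coeff (coeff P j) i) (falling j))"

text \<open>
  The local exponents with multiplicity.  Since the coordinate at infinity is \<open>1/x\<close>, an exponent
  \<open>s\<close> there means behaviour \<open>x^(-s)\<close>.
\<close>

definition local_exponents :: "diffop \<Rightarrow> point \<Rightarrow> complex multiset" where
  "local_exponents P pt = proots (indicial (local_op P pt))"

definition regular_singular_point :: "diffop \<Rightarrow> point \<Rightarrow> bool" where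
  "regular_singular_point P pt \<longleftrightarrow>
     singular_point P pt \<and> degree (indicial (local_op P pt)) = degree (local_op P pt)"

text \<open>The set \<open>S\<close> lists exactly the singular points, each with its column of exponents.\<close>

definition has_riemann_scheme :: "diffop \<Rightarrow> (point \<times> complex multiset) set \<Rightarrow> bool" where
  "has_riemann_scheme P S \<longleftrightarrow>
     (\<forall>pt. singular_point P pt \<longrightarrow> regular_singular_point P pt) \<and>
     S = {(pt, local_exponents P pt) | pt. singular_point P pt}"

text \<open>
  A polynomial in four variables is an iterated univariate polynomial, the outermost indeterminate
  being the last variable.
\<close>

definition poly4 :: "complex poly poly poly poly \<Rightarrow> complex \<Rightarrow> complex \<Rightarrow> complex \<Rightarrow> complex \<Rightarrow> complex"
  where "poly4 F a0 a1 a2 a3 = poly (poly (poly (poly F [:[:[:a3:]:]:]) [:[:a2:]:]) [:a1:]) a0"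

definition for_generic ::
  "(complex \<Rightarrow> complex \<Rightarrow> complex \<Rightarrow> complex \<Rightarrow> bool) \<Rightarrow> bool" where
  "for_generic \<Phi> \<longleftrightarrow> (\<exists>\<F>. countable \<F> \<and> 0 \<notin> \<F> \<and>
     (\<forall>a0 a1 a2 a3. (\<forall>F\<in>\<F>. poly4 F a0 a1 a2 a3 \<noteq> 0) \<longrightarrow> \<Phi> a0 a1 a2 a3))"

definition Z_tilde :: "complex \<Rightarrow> complex \<Rightarrow> complex \<Rightarrow> complex \<Rightarrow> diffop" where
  "Z_tilde A0 A1 A2 A3 =
    (let m1 = 4 * (X - 1) * X * (2 * X - 1);
         m2 = smult (1/4)
               (smult (4 * A0^2) X - [:4 * A0^2:] - smult (4 * A1^2) X
                - smult (4 * A2^2) (X^2) + smult (4 * A2^2) X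
                - smult (4 * A3^2) (X^2) + smult (4 * A3^2) X
                + 58 * X^2 - 58 * X + 9);
         m3 = smult (1/2)
               ([:2 * A0^2:] - [:2 * A1^2:] - smult (4 * A2^2) X + [:2 * A2^2:]
                - smult (4 * A3^2) X + [:2 * A3^2:] + 10 * X - 5);
         m4 = [:(A2 - 1/2) * (A2 + 1/2) * (A3 - 1/2) * (A3 + 1/2):]
     in [:m4, m3, m2, m1, X^2 * (X - 1)^2:])"

end

theory Submission
  imports Defs
begin

text \<open>
  All monomials \<open>x^i \<partial>^j\<close> of \<open>Z_tilde\<close> satisfy \<open>i \<le> j\<close>, so no multiplication by \<open>\<partial>\<close> is needed,
  and its \<open>\<theta>\<close>-form is \<open>f\<^sub>0(\<theta>) + f\<^sub>1(\<theta>) \<partial> + f\<^sub>2(\<theta>) \<partial>^2\<close> with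
  \<open>f\<^sub>0(\<theta>) = ((\<theta> + 1/2)^2 - A\<^sub>2^2) ((\<theta> + 1/2)^2 - A\<^sub>3^2)\<close>.  The shift \<open>\<theta> \<mapsto> \<theta> + 1/2 + A\<^sub>2\<close> turns one
  factor of \<open>f\<^sub>0\<close> into \<open>\<theta> + 1 = \<partial> x\<close>, which makes the operator divisible by \<open>\<partial>\<close> from the left.
  A second division is impossible for generic parameters: the adjoint of \<open>\<partial> S\<close> annihilates \<open>1\<close>,
  whereas the adjoint of \<open>Q\<close> maps \<open>1\<close> to a polynomial with linear coefficient
  \<open>(2 A\<^sub>2 - 1) ((A\<^sub>2 - 1)^2 - A\<^sub>3^2)\<close>.  The exponents are read off from the explicit indicial
  polynomials.
\<close>

section \<open>Left multiplication by \<partial> and division by it\<close>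

lemma coeff_lmul_d:
  "coeff (lmul_d P) j = (case j of 0 \<Rightarrow> 0 | Suc k \<Rightarrow> coeff P k) + pderiv (coeff P j)"
  by (simp add: lmul_d_def coeff_pCons coeff_map_poly split: nat.splits)

lemma lmul_d_0 [simp]: "lmul_d 0 = 0"
  by (simp add: lmul_d_def)

lemma lmul_d_add: "lmul_d (P + Q) = lmul_d P + lmul_d Q"
  by (rule poly_eqI) (simp add: coeff_lmul_d pderiv_add split: nat.splits)

lemma lmul_d_smult_const: "lmul_d (smult [:c:] P) = smult [:c:] (lmul_d P)"
  by (rule poly_eqI) (simp add: coeff_lmul_d pderiv_smult smult_add_right split: nat.splits)

lemma lmul_d_pCons: "lmul_d (pCons p P) = pCons (pderiv p) (pCons p 0 + lmul_d P)"
  by (rule poly_eqI) (simp add: coeff_lmul_d coeff_pCons split: nat.splits)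

lemma degree_lmul_d:
  assumes "P \<noteq> 0"
  shows "degree (lmul_d P) = Suc (degree P)"
proof (rule antisym)
  show "degree (lmul_d P) \<le> Suc (degree P)"
    by (rule degree_le) (auto simp: coeff_lmul_d coeff_eq_0 split: nat.splits)
  have "coeff (lmul_d P) (Suc (degree P)) \<noteq> 0"
    using assms by (simp add: coeff_lmul_d coeff_eq_0)
  then show "Suc (degree P) \<le> degree (lmul_d P)"
    by (rule le_degree)
qed

lemma lmul_d_eq_0_iff [simp]: "lmul_d P = 0 \<longleftrightarrow> P = 0"
  using degree_lmul_d by fastforce

text \<open>The map is additive, and its kernel is trivial because \<partial> raises the order of a
  nonzero operator by exactly one.\<close>

lemma inj_lmul_d: "inj lmul_d"
proof (rule injI)
  fix P Q assume "lmul_d P = lmul_d Q"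
  moreover have "lmul_d Q + lmul_d (P - Q) = lmul_d P"
    by (simp flip: lmul_d_add)
  ultimately show "P = Q"
    by simp
qed

text \<open>The smaller of two powers of \<partial> cancels by injectivity; a power left over would
  make \<open>R\<close> or its competitor divisible by \<partial>.\<close>

lemma strip_d_lmul_d_power:
  assumes "\<nexists>S. R = lmul_d S"
  shows "strip_d ((lmul_d ^^ k) R) = R"
  unfolding strip_d_def
proof (rule the_equality, use assms in blast)
  fix R' assume *: "(\<exists>l. (lmul_d ^^ k) R = (lmul_d ^^ l) R') \<and> (\<nexists>S. R' = lmul_d S)"
  then obtain l where l: "(lmul_d ^^ k) R = (lmul_d ^^ l) R'" by blast
  have aux: "U = V" if "(lmul_d ^^ a) U = (lmul_d ^^ b) V" "a \<le> b" "\<nexists>S. U = lmul_d S"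
    for U V a b
  proof -
    from that(2) obtain d where d: "b = a + d" using le_Suc_ex by blast
    have "inj (lmul_d ^^ a)" by (rule inj_fn[OF inj_lmul_d])
    moreover have "(lmul_d ^^ a) U = (lmul_d ^^ a) ((lmul_d ^^ d) V)"
      using that(1) by (simp add: d funpow_add)
    ultimately have "U = (lmul_d ^^ d) V" by (simp add: inj_eq)
    with that(3) show ?thesis by (cases d) auto
  qed
  show "R' = R"
    using aux[of k R l R'] aux[of l R' k R] l assms * by (cases "k \<le> l") auto
qed

text \<open>
  The formal adjoint of \<open>P\<close> applied to the constant \<open>1\<close>; it vanishes on \<open>\<partial> S\<close> because the adjoint
  of \<open>\<partial> S\<close> is \<open>- S\<^sup>* \<partial>\<close>.
\<close>

definition adjoint_one :: "diffop \<Rightarrow> complex poly" where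
  "adjoint_one P = (\<Sum>j\<le>degree P. (-1) ^ j * (pderiv ^^ j) (coeff P j))"

lemma adjoint_one_altdef:
  assumes "degree P \<le> n"
  shows "adjoint_one P = (\<Sum>j\<le>n. (-1) ^ j * (pderiv ^^ j) (coeff P j))"
  unfolding adjoint_one_def using assms
  by (intro sum.mono_neutral_left) (auto simp: coeff_eq_0)

lemma adjoint_one_lmul_d: "adjoint_one (lmul_d S) = 0"
proof -
  let ?g = "\<lambda>j. (-1) ^ j * (pderiv ^^ Suc j) (coeff S j)"
  have deg: "degree (lmul_d S) \<le> Suc (degree S)"
    by (cases "S = 0") (auto simp: degree_lmul_d)
  \<comment> \<open>The sum telescopes: up to \<open>n\<close> only the boundary term remains, and
    it vanishes once \<open>n\<close> exceeds the order of \<open>S\<close>.\<close>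
  have "(\<Sum>j\<le>n. (-1) ^ j * (pderiv ^^ j) (coeff (lmul_d S) j)) = ?g n" for n
    by (induction n)
       (simp_all add: coeff_lmul_d higher_pderiv_add algebra_simps funpow_swap1)
  from this[of "Suc (degree S)"] show ?thesis
    by (simp add: adjoint_one_altdef[OF deg] coeff_eq_0)
qed

section \<open>Operators given by polynomials in \<theta>\<close>

lemma lmul_theta_smult_const: "lmul_theta (smult [:c:] P) = smult [:c:] (lmul_theta P)"
  by (simp add: lmul_theta_def lmul_d_smult_const mult.commute)

lemma lmul_theta_add: "lmul_theta (P + Q) = lmul_theta P + lmul_theta Q"
  by (simp add: lmul_theta_def lmul_d_add smult_add_right)

lemma lmul_theta_0 [simp]: "lmul_theta 0 = 0"
  by (simp add: lmul_theta_def)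

text \<open>The composition f(\<theta>) L, isolated as the inner sum of
  \<open>of_theta\<close>.\<close>

definition theta_act :: "complex poly \<Rightarrow> diffop \<Rightarrow> diffop" where
  "theta_act f L = (\<Sum>i\<le>degree f. smult [:coeff f i:] ((lmul_theta ^^ i) L))"

lemma theta_act_altdef:
  assumes "degree f \<le> n"
  shows "theta_act f L = (\<Sum>i\<le>n. smult [:coeff f i:] ((lmul_theta ^^ i) L))"
  unfolding theta_act_def using assms
  by (intro sum.mono_neutral_left) (auto simp: coeff_eq_0)

lemma theta_act_0 [simp]: "theta_act 0 L = 0"
  by (simp add: theta_act_def)

text \<open>Horner's rule, by which explicit polynomials in \<theta> are evaluated by
  simplification.\<close>

lemma theta_act_pCons:
  "theta_act (pCons a f) L = smult [:a:] L + lmul_theta (theta_act f L)"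
proof -
  have lin: "lmul_theta (sum g A) = (\<Sum>i\<in>A. lmul_theta (g i))" for g and A :: "nat set"
    by (induction A rule: infinite_finite_induct) (simp_all add: lmul_theta_add)
  have "theta_act (pCons a f) L =
      (\<Sum>i\<le>Suc (degree f). smult [:coeff (pCons a f) i:] ((lmul_theta ^^ i) L))"
    by (rule theta_act_altdef) (rule degree_pCons_le)
  also have "\<dots> = smult [:a:] L + (\<Sum>i\<le>degree f. smult [:coeff f i:] ((lmul_theta ^^ Suc i) L))"
    by (subst sum.atMost_Suc_shift) simp
  finally show ?thesis
    by (simp add: theta_act_def lin lmul_theta_smult_const)
qed

lemma of_theta_altdef:
  assumes "degree T \<le> n"
  shows "of_theta T = (\<Sum>j\<le>n. theta_act (coeff T j) (monom 1 j))"
  unfolding of_theta_def theta_act_def[symmetric] using assms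
  by (intro sum.mono_neutral_left) (auto simp: coeff_eq_0)

section \<open>Supports, and working formulas for \<open>mc\<close> and
  \<open>indicial\<close>\<close>

lemma finite_supp: "finite (supp P)"
proof (rule finite_subset)
  show "supp P \<subseteq> (\<lambda>(j, i). (i, j)) ` (SIGMA j:{..degree P}. {..degree (coeff P j)})"
    by (force simp: supp_def intro: le_degree)
qed auto

text \<open>Absent monomials contribute 0. A superset is convenient because the exact support
  depends on the parameters.\<close>

lemma to_theta_altdef:
  assumes "finite S" "supp P \<subseteq> S"
  shows "to_theta P = (\<Sum>(i, j)\<in>S. monom (smult (coeff (coeff P j) i) (falling i)) (j - i))"
  unfolding to_theta_def using assms
  by (intro sum.mono_neutral_left) (auto simp: supp_def)

text \<open>If every monomial has i \<le> j, then r \<le> 0 and \<open>nat r = 0\<close>, so the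
  premultiplication by \<partial> disappears.\<close>

lemma mc_eqI:
  assumes "P \<noteq> 0" "\<And>i j. (i, j) \<in> supp P \<Longrightarrow> i \<le> j"
    and "of_theta (map_poly (\<lambda>f. f \<circ>\<^sub>p [:-\<mu>, 1:]) (to_theta P)) = (lmul_d ^^ k) R"
    and "\<nexists>S. R = lmul_d S"
  shows "mc \<mu> P = R"
proof -
  from \<open>P \<noteq> 0\<close> obtain j where j: "coeff P j \<noteq> 0"
    by (meson leading_coeff_0_iff)
  \<comment> \<open>The bound on \<open>Max\<close> requires a nonempty set, so one monomial is
    exhibited.\<close>
  then have "(degree (coeff P j), j) \<in> supp P" by (simp add: supp_def)
  then have "Max ((\<lambda>(i, j). int i - int j) ` supp P) \<le> 0"
    using assms(2) by (subst Max_le_iff) (auto simp: finite_supp)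
  with assms(3,4) show ?thesis
    by (simp add: mc_def strip_d_lmul_d_power)
qed

text \<open>On the diagonal i - j = e the index j determines i, so the sum over monomials becomes a
  sum over j whose range is independent of the parameters.\<close>

lemma indicial_altdef:
  assumes "\<And>i j. (i, j) \<in> supp P \<Longrightarrow> e \<le> int i - int j"
    and "(i0, j0) \<in> supp P" "int i0 - int j0 = e" and "degree P \<le> n"
  shows "indicial P = (\<Sum>j\<le>n. if 0 \<le> int j + e
           then smult (coeff (coeff P j) (nat (int j + e))) (falling j) else 0)"
proof -
  have Min: "Min ((\<lambda>(i, j). int i - int j) ` supp P) = e"
    using assms(1-3) by (intro Min_eqI) (force simp: finite_supp)+
  let ?J = "{j \<in> {..n}. 0 \<le> int j + e \<and> coeff (coeff P j) (nat (int j + e)) \<noteq> 0}"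
  have le: "j \<le> n" if "(i, j) \<in> supp P" for i j
  proof -
    have "coeff P j \<noteq> 0" using that by (auto simp: supp_def)
    with assms(4) show ?thesis by (meson le_degree order.trans)
  qed
  have "indicial P = (\<Sum>(i, j)\<in>{(i, j)\<in>supp P. int i - int j = e}.
      smult (coeff (coeff P j) i) (falling j))"
    by (simp add: indicial_def Min)
  also have "\<dots> = (\<Sum>j\<in>?J. smult (coeff (coeff P j) (nat (int j + e))) (falling j))"
    by (rule sum.reindex_bij_witness[of _ "\<lambda>j. (nat (int j + e), j)" snd])
       (auto simp: supp_def intro: le)
  also have "\<dots> = (\<Sum>j\<le>n. if 0 \<le> int j + e
           then smult (coeff (coeff P j) (nat (int j + e))) (falling j) else 0)"
    by (rule sum.mono_neutral_cong_left) auto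
  finally show ?thesis .
qed

lemma coeff_monom_mult_reflect_poly:
  fixes p :: "complex poly"
  assumes "degree p \<le> N"
  shows "coeff (monom 1 (N - degree p) * reflect_poly p) k = (if k \<le> N then coeff p (N - k) else 0)"
  using assms
  by (auto simp: coeff_monom_mult coeff_reflect_poly coeff_eq_0 not_le)

section \<open>The explicit operators and the middle convolution\<close>

lemma falling_simps:
  "falling 0 = 1" "falling 1 = [:0, 1:]" "falling (Suc 0) = [:0, 1:]" "falling 2 = [:0, -1, 1:]"
  "falling 3 = [:0, 2, -3, 1:]" "falling 4 = [:0, -6, 11, -6, 1:]"
  by (simp_all add: falling_def numeral_eq_Suc lessThan_Suc one_pCons)

text \<open>The asserted operator Q(A), expanded in powers of x. The squares
  \<open>(A2 + 1)^2\<close> are kept because their differences with \<open>A0^2\<close> and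
  \<open>A3^2\<close> enter the indicial polynomials.\<close>

definition Q_op :: "complex \<Rightarrow> complex \<Rightarrow> complex \<Rightarrow> complex \<Rightarrow> diffop" where
  "Q_op A0 A1 A2 A3 =
    [:[:(2 * A2 + 1) * (A0^2 - A1^2 - (A2 + 1)^2 + A3^2) / 2, (2 * A2 + 1) * ((A2 + 1)^2 - A3^2):],
      [:(A2 + 1)^2 - A0^2, A0^2 - A1^2 - 5 * A2^2 - 12 * A2 + A3^2 - 7, 5 * A2^2 + 12 * A2 - A3^2 + 7:],
      [:0, 2 * A2 + 3, - 3 * (2 * A2 + 3), 2 * (2 * A2 + 3):],
      [:0, 0, 1, - 2, 1:]:]"

lemma Z_tilde_eq:
  "Z_tilde A0 A1 A2 A3 =
    [:[:(A2^2 - 1/4) * (A3^2 - 1/4):],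
      [:A0^2 - A1^2 + A2^2 + A3^2 - 5/2, 5 - 2 * A2^2 - 2 * A3^2:],
      [:9/4 - A0^2, A0^2 - A1^2 + A2^2 + A3^2 - 29/2, 29/2 - A2^2 - A3^2:],
      [:0, 4, - 12, 8:],
      [:0, 0, 1, - 2, 1:]:]"
  unfolding Z_tilde_def Let_def
  by (simp add: power2_eq_square numeral_poly one_pCons)
     (simp add: field_simps)

lemma supp_pCons: "(i, j) \<in> supp (pCons p P) \<longleftrightarrow>
    (case j of 0 \<Rightarrow> coeff p i \<noteq> 0 | Suc k \<Rightarrow> (i, k) \<in> supp P)"
  by (auto simp: supp_def coeff_pCons split: nat.splits)

lemma supp_0: "supp 0 = {}"
  by (simp add: supp_def)

text \<open>The coefficients are variables, so the support is bounded without deciding which of them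
  vanish.\<close>

lemma supp_order_4:
  "supp [:[:a:], [:b, c:], [:d, e, f:], [:0, g, h, k:], [:0, 0, l, m, n:]:] \<subseteq>
     {(0, 0), (0, 1), (1, 1), (0, 2), (1, 2), (2, 2), (1, 3), (2, 3), (3, 3), (2, 4), (3, 4), (4, 4)}"
proof (rule subrelI)
  fix i j assume "(i, j) \<in> supp [:[:a:], [:b, c:], [:d, e, f:], [:0, g, h, k:], [:0, 0, l, m, n:]:]"
  then consider "j = 0" "coeff [:a:] i \<noteq> 0" | "j = 1" "coeff [:b, c:] i \<noteq> 0"
    | "j = 2" "coeff [:d, e, f:] i \<noteq> 0" | "j = 3" "coeff [:0, g, h, k:] i \<noteq> 0"
    | "j = 4" "coeff [:0, 0, l, m, n:] i \<noteq> 0"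
    by (auto simp: supp_pCons supp_0 split: nat.splits)
  then show "(i, j) \<in>
     {(0, 0), (0, 1), (1, 1), (0, 2), (1, 2), (2, 2), (1, 3), (2, 3), (3, 3), (2, 4), (3, 4), (4, 4)}"
    by cases (auto simp: coeff_pCons split: nat.splits)
qed

lemmas supp_Z_tilde = supp_order_4[of "(A2^2 - 1/4) * (A3^2 - 1/4)"
  "A0^2 - A1^2 + A2^2 + A3^2 - 5/2" "5 - 2 * A2^2 - 2 * A3^2"
  "9/4 - A0^2" "A0^2 - A1^2 + A2^2 + A3^2 - 29/2" "29/2 - A2^2 - A3^2" 4 "- 12" 8 1 "- 2" 1,
  folded Z_tilde_eq] for A0 A1 A2 A3

lemma coeff_pCons_numerals:
  fixes a :: "'a :: zero"
  shows "coeff (pCons a p) 1 = coeff p 0" "coeff (pCons a p) 2 = coeff p 1"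
    "coeff (pCons a p) 3 = coeff p 2" "coeff (pCons a p) 4 = coeff p 3"
  by (simp_all add: numeral_eq_Suc)

lemma monom_1_2: "monom c 1 = [:0, c:]" "monom c 2 = [:0, 0, c:]"
  by (simp_all add: monom_0 monom_Suc numeral_eq_Suc)

text \<open>\<open>pCons 0\<close> is composition with \<partial> from the right, hence commutes
  with the left action of \<theta>.\<close>

lemma lmul_theta_pCons_0: "lmul_theta (pCons 0 P) = pCons 0 (lmul_theta P)"
  by (simp add: lmul_theta_def lmul_d_pCons)

lemma theta_act_pCons_0: "theta_act f (pCons 0 L) = pCons 0 (theta_act f L)"
  by (induction f) (simp_all add: theta_act_pCons lmul_theta_pCons_0)

text \<open>The numerical factors are Stirling numbers: \<open>\<theta>^i = (\<Sum>k. S(i, k) x^k \<partial>^k)\<close>.\<close>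

lemma theta_act_1:
  "theta_act [:a, b, c, d, e:] 1 =
    [:[:a:], [:0, b + c + d + e:], [:0, 0, c + 3 * d + 7 * e:], [:0, 0, 0, d + 6 * e:], [:0, 0, 0, 0, e:]:]"
  by (simp add: theta_act_pCons lmul_theta_def lmul_d_pCons pderiv_pCons one_pCons algebra_simps)

lemma to_theta_Z_tilde:
  "to_theta (Z_tilde A0 A1 A2 A3) =
    [:[:1/2 + A2, 1:] * [:1/2 - A2, 1:] * [:1/2 + A3, 1:] * [:1/2 - A3, 1:],
      [:A0^2 - A1^2 + A2^2 + A3^2 - 5/2, A0^2 - A1^2 + A2^2 + A3^2 - 13/2, - 6, - 2:],
      [:9/4 - A0^2, 3, 1:]:]"
proof (subst to_theta_altdef[OF _ supp_Z_tilde], goal_cases)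
  case 2
  show ?case
    by (simp add: Z_tilde_eq coeff_pCons_numerals falling_simps monom_0 monom_1_2[simplified])
       (simp add: one_pCons field_simps power2_eq_square)
qed simp

lemma of_theta_3:
  "of_theta [:f, g, h:] = theta_act f 1 + pCons 0 (theta_act g 1) + pCons 0 (pCons 0 (theta_act h 1))"
proof -
  have "degree [:f, g, h:] \<le> 2"
    by (rule degree_le) (auto simp: coeff_pCons numeral_eq_Suc split: nat.splits)
  then have "of_theta [:f, g, h:] = (\<Sum>j\<le>2. theta_act (coeff [:f, g, h:] j) (monom 1 j))"
    by (rule of_theta_altdef)
  then show ?thesis
    by (simp add: numeral_eq_Suc monom_0 monom_Suc theta_act_pCons_0 flip: one_pCons)
qed

text \<open>The terms containing \<partial> do not obstruct divisibility, as f(\<theta>) \<partial>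
  = \<partial> f(\<theta> - 1). The equality itself is checked by comparing coefficients of the
  normal forms.\<close>

lemma of_theta_shift:
  "of_theta (map_poly (\<lambda>f. f \<circ>\<^sub>p [:-(- 1/2 - A2), 1:]) (to_theta (Z_tilde A0 A1 A2 A3)))
     = lmul_d (Q_op A0 A1 A2 A3)"
proof -
  define c where "c = A0^2 - A1^2 + A2^2 + A3^2"
  define n where "n = A2 + 1/2"
  \<comment> \<open>The shifted constant term of the \<theta>-form is (\<theta> + 1) (\<theta> + a)
    (\<theta>^2 + 2 (1 + A2) \<theta> + b), expanded in \<open>?f\<close>; \<open>n\<close> above is
    the shift -\<mu>.\<close>
  define a b where "a = 1 + 2 * A2" and "b = (1 + A2)^2 - A3^2"
  let ?f = "[:a * b, a * b + b + 2 * (1 + A2) * a, b + 2 * (1 + A2) * (1 + a) + a, 2 * (1 + A2) + 1 + a, 1:]"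
  \<comment> \<open>The trailing zeros of \<open>?g\<close> and \<open>?h\<close> pad to the five
    coefficients expected by \<open>theta_act_1\<close>.\<close>
  let ?g = "[:c - 5/2 + (c - 13/2) * n - 6 * n^2 - 2 * n^3, c - 13/2 - 12 * n - 6 * n^2, - 6 - 6 * n, - 2, 0:]"
  let ?h = "[:9/4 - A0^2 + 3 * n + n^2, 3 + 2 * n, 1, 0, 0:]"
  have 1: "([:1/2 + A2, 1:] * [:1/2 - A2, 1:] * [:1/2 + A3, 1:] * [:1/2 - A3, 1:]) \<circ>\<^sub>p [:-(- 1/2 - A2), 1:]
    = ?f"
    by (simp add: pcompose_mult pcompose_pCons a_def b_def field_simps power2_eq_square)
  have 2: "[:c - 5/2, c - 13/2, - 6, - 2:] \<circ>\<^sub>p [:-(- 1/2 - A2), 1:] = ?g"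
    by (simp add: pcompose_pCons n_def field_simps power2_eq_square power3_eq_cube)
  have 3: "[:9/4 - A0^2, 3, 1:] \<circ>\<^sub>p [:-(- 1/2 - A2), 1:] = ?h"
    by (simp add: pcompose_pCons n_def field_simps power2_eq_square power3_eq_cube)
  have "map_poly (\<lambda>f. f \<circ>\<^sub>p [:-(- 1/2 - A2), 1:]) (to_theta (Z_tilde A0 A1 A2 A3)) = [:?f, ?g, ?h:]"
    unfolding to_theta_Z_tilde c_def[symmetric]
    by (simp only: map_poly_pCons pcompose_0 map_poly_0 1 2 3)
  then have eq: "of_theta (map_poly (\<lambda>f. f \<circ>\<^sub>p [:-(- 1/2 - A2), 1:]) (to_theta (Z_tilde A0 A1 A2 A3)))
    = theta_act ?f 1 + pCons 0 (theta_act ?g 1) + pCons 0 (pCons 0 (theta_act ?h 1))"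
    by (simp only: of_theta_3)
  show ?thesis
    unfolding eq theta_act_1
    unfolding lmul_d_pCons Q_op_def pderiv_pCons add_pCons pderiv_0 lmul_d_0 add_0_left add_0_right
      pCons_eq_iff pCons_0_0 a_def b_def c_def n_def
    by (intro conjI; simp add: field_simps power2_eq_square power3_eq_cube)
qed

section \<open>Singular points and local exponents of Q\<close>

lemma order_0_pCons:
  fixes p :: "complex poly"
  shows "c \<noteq> 0 \<Longrightarrow> order 0 (pCons c p) = 0"
    and "p \<noteq> 0 \<Longrightarrow> order 0 (pCons 0 p) = Suc (order 0 p)"
proof -
  show "order 0 (pCons c p) = 0" if "c \<noteq> 0"
    using that by (intro order_0I) simp
  assume "p \<noteq> 0"
  have eq: "pCons 0 p = [:- 0, 1:] * p" by simp
  have "[:- 0, 1:] * p \<noteq> 0" using \<open>p \<noteq> 0\<close> by simp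
  from order_mult[OF this, of 0] show "order 0 (pCons 0 p) = Suc (order 0 p)"
    unfolding eq using order_power_n_n[of 0 1] by simp
qed

lemma not_lmul_d_Q_op:
  assumes "2 * A2 - 1 \<noteq> 0" "A2 - 1 + A3 \<noteq> 0" "A2 - 1 - A3 \<noteq> 0"
  shows "\<nexists>S. Q_op A0 A1 A2 A3 = lmul_d S"
proof
  assume "\<exists>S. Q_op A0 A1 A2 A3 = lmul_d S"
  then have "adjoint_one (Q_op A0 A1 A2 A3) = 0"
    by (auto simp: adjoint_one_lmul_d)
  then have "coeff (adjoint_one (Q_op A0 A1 A2 A3)) 1 = 0" by simp
  moreover have "coeff (adjoint_one (Q_op A0 A1 A2 A3)) 1
    = (2 * A2 - 1) * (A2 - 1 + A3) * (A2 - 1 - A3)"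
  proof -
    have "degree (Q_op A0 A1 A2 A3) \<le> Suc (Suc (Suc 0))" by (simp add: Q_op_def)
    from adjoint_one_altdef[OF this] show ?thesis
      by (simp add: Q_op_def pderiv_pCons) (simp add: field_simps power2_eq_square)
  qed
  ultimately show False using assms by simp
qed

text \<open>Only d \<partial>, g x \<partial>^2 and x^2 \<partial>^3 have the lowest weight -1. They
  give t (d + g (t - 1) + (t - 1) (t - 2)) = t ((t + s)^2 - B^2). This shape serves x = 0 with B =
  A0 and x = 1 with B = A1.\<close>

lemma indicial_at_0:
  assumes "g = 2 * s + 3" "d = (s + 1)^2 - B^2"
  shows "indicial [:[:u, v:], [:d, e, f:], [:0, g, h, k:], [:0, 0, 1, m, n:]:]
    = [:0, 1:] * [:s + B, 1:] * [:s - B, 1:]" (is "indicial ?L = _")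
proof -
  have 1: "- 1 \<le> int i - int j" if "(i, j) \<in> supp ?L" for i j
    using that by (auto simp: supp_pCons supp_0 coeff_pCons split: nat.splits)
  have 2: "(2, 3) \<in> supp ?L"
    by (simp add: supp_def coeff_pCons_numerals)
  have "degree ?L \<le> 3" by simp
  from indicial_altdef[OF 1 2 _ this]
  have "indicial ?L = smult d [:0, 1:] + smult g [:0, -1, 1:] + [:0, 2, -3, 1:]"
    by (simp add: atMost_nat_numeral falling_simps coeff_pCons_numerals nat_diff_distrib)
  then show ?thesis
    unfolding assms by (simp add: field_simps power2_eq_square)
qed

lemma proots_linear_product:
  "proots ([:a, 1:] * [:b, 1:] * [:c, 1 :: complex:]) = {#- a, - b, - c#}"
proof -
  have "proots [:a, 1:] = {#- a#}" for a :: complex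
    using proots_linear_factor[of "- a"] by simp
  then show ?thesis
    by (simp add: proots_mult no_zero_divisors add_mset_commute del: mult_pCons_left mult_pCons_right)
qed

lemma regular_singular_0:
  assumes "g = 2 * s + 3" "d = (s + 1)^2 - B^2" "g \<noteq> 0"
    and "local_op P pt = [:[:u, v:], [:d, e, f:], [:0, g, h, k:], [:0, 0, 1, m, n:]:]"
  shows "regular_singular_point P pt" "local_exponents P pt = {#0, - B - s, B - s#}"
proof -
  have "singular_point P pt"
    unfolding singular_point_def assms(4) Let_def using assms(3)
    \<comment> \<open>The coefficient of \<partial>^2 has order 1 because g \<noteq> 0, while the
      leading coefficient has order 2.\<close>
    by (intro exI[of _ 2]) (simp add: coeff_pCons_numerals order_0_pCons)
  moreover have "degree (indicial (local_op P pt)) = degree (local_op P pt)"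
    unfolding assms(4) indicial_at_0[OF assms(1,2)] by simp
  ultimately show "regular_singular_point P pt"
    by (simp add: regular_singular_point_def)
  show "local_exponents P pt = {#0, - B - s, B - s#}"
    unfolding local_exponents_def assms(4) indicial_at_0[OF assms(1,2)] proots_linear_product
    by simp
qed

text \<open>The leading coefficient is monic of degree 4, which forces N = 4 whatever the other
  entries are.\<close>

lemma op_at_infinity_eq:
  "op_at_infinity [:[:u, v:], [:d, e, f:], [:0, g, h, k:], [:0, 0, 1, m, 1:]:] =
    [:[:0, 0, 0, v, u:],
      [:0, 0, 0, 0, 2 * k - f - 6, 2 * h - e - 6 * m, 2 * g - d - 6:],
      [:0, 0, 0, 0, 0, k - 6, h - 6 * m, g - 6:],
      [:0, 0, 0, 0, 0, 0, - 1, - m, - 1:]:]" (is "op_at_infinity ?P = _")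
proof -
  let ?N = "Max ((\<lambda>j. degree (coeff ?P j)) ` {..degree ?P})"
  have N: "?N = 4"
    by (rule Max_eqI) (auto simp: atMost_nat_numeral coeff_pCons_numerals numeral_eq_Suc atMost_Suc)
  have rev: "monom 1 (4 - degree p) * reflect_poly p = [:coeff p 4, coeff p 3, coeff p 2, coeff p 1, coeff p 0:]"
    if "degree p \<le> 4" for p :: "complex poly"
    using that by (intro poly_eqI)
      (auto simp: coeff_monom_mult_reflect_poly coeff_pCons numeral_eq_Suc split: nat.splits)
  define R where "R = (\<lambda>p :: complex poly. monom 1 (4 - degree p) * reflect_poly p)"
  have R: "R [:u, v:] = [:0, 0, 0, v, u:]" "R [:d, e, f:] = [:0, 0, f, e, d:]"
    "R [:0, g, h, k:] = [:0, k, h, g:]" "R [:0, 0, 1, m, 1:] = [:1, m, 1:]"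
    unfolding R_def by (subst rev; simp add: coeff_pCons_numerals)+
  define D where "D = (\<lambda>L. smult (- (X ^ 2)) (lmul_d L))"
  have D: "(D ^^ 0) 1 = 1" "(D ^^ 1) 1 = [:0, [:0, 0, - 1:]:]"
    "(D ^^ 2) 1 = [:0, [:0, 0, 0, 2:], [:0, 0, 0, 0, 1:]:]"
    "(D ^^ 3) 1 = [:0, [:0, 0, 0, 0, - 6:], [:0, 0, 0, 0, 0, - 6:], [:0, 0, 0, 0, 0, 0, - 1:]:]"
    by (simp_all add: D_def numeral_eq_Suc lmul_d_pCons one_pCons pderiv_pCons)
  have "degree ?P = 3" by simp
  then have "op_at_infinity ?P = (\<Sum>j\<le>3. smult (R (coeff ?P j)) ((D ^^ j) 1))"
    unfolding op_at_infinity_def N Let_def R_def D_def by (simp only:)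
  also have "\<dots> = smult (R [:u, v:]) ((D ^^ 0) 1) + smult (R [:d, e, f:]) ((D ^^ 1) 1)
     + smult (R [:0, g, h, k:]) ((D ^^ 2) 1) + smult (R [:0, 0, 1, m, 1:]) ((D ^^ 3) 1)"
    by (simp add: atMost_nat_numeral coeff_pCons_numerals add_ac)
  finally show ?thesis
    unfolding R D by (simp add: one_pCons algebra_simps)
qed

lemma indicial_at_infinity:
  "indicial [:[:0, 0, 0, v, u:], [:0, 0, 0, 0, a, b, c:], [:0, 0, 0, 0, 0, d, e, f:],
     [:0, 0, 0, 0, 0, 0, - 1, g, h:]:]
   = [:v:] + smult a [:0, 1:] + smult d [:0, -1, 1:] - [:0, 2, -3, 1:]" (is "indicial ?L = _")
proof -
  have 1: "3 \<le> int i - int j" if "(i, j) \<in> supp ?L" for i j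
    using that by (auto simp: supp_pCons supp_0 coeff_pCons split: nat.splits)
  \<comment> \<open>The monomial - w^6 (d/dw)^3 attains the lowest weight 3 for all
    parameters.\<close>
  have 2: "(6, 3) \<in> supp ?L"
    by (simp add: supp_def numeral_eq_Suc)
  have "degree ?L \<le> 3" by simp
  from indicial_altdef[OF 1 2 _ this] show ?thesis
    by (simp add: atMost_nat_numeral falling_simps coeff_pCons_numerals nat_add_distrib)
       (simp add: numeral_eq_Suc one_pCons)
qed

lemma indicial_Q_op_at_infinity:
  "indicial (op_at_infinity (Q_op A0 A1 A2 A3)) =
     smult (- 1) ([:- (1 + 2 * A2), 1:] * [:- (1 + A2 - A3), 1:] * [:- (1 + A2 + A3), 1:])"
  unfolding Q_op_def op_at_infinity_eq indicial_at_infinity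
  by (simp add: field_simps power2_eq_square)

lemma regular_singular_Q_op_infinity:
  assumes "2 * A2 + 1 \<noteq> 0" "A2 + 1 + A3 \<noteq> 0" "A2 + 1 - A3 \<noteq> 0"
  shows "regular_singular_point (Q_op A0 A1 A2 A3) Infty"
    and "local_exponents (Q_op A0 A1 A2 A3) Infty = {#1 + 2 * A2, 1 + A2 - A3, 1 + A2 + A3#}"
proof -
  let ?Q = "Q_op A0 A1 A2 A3"
  have deg: "degree (op_at_infinity ?Q) = 3"
    by (simp add: Q_op_def op_at_infinity_eq)
  have "(2 * A2 + 1) * ((A2 + 1)^2 - A3^2) = (2 * A2 + 1) * (A2 + 1 + A3) * (A2 + 1 - A3)"
    by (simp add: field_simps power2_eq_square)
  with assms have "(2 * A2 + 1) * ((A2 + 1)^2 - A3^2) \<noteq> 0"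
    by (simp del: mult_eq_0_iff) (simp only: mult_eq_0_iff, simp)
  then have "singular_point ?Q Infty"
    unfolding singular_point_def local_op.simps Let_def Q_op_def op_at_infinity_eq
    \<comment> \<open>The coefficient of order 0 starts at w^3 with the nonzero product above, while
      the leading coefficient starts at w^6.\<close>
    by (intro exI[of _ 0]) (simp add: order_0_pCons)
  moreover have "degree (indicial (op_at_infinity ?Q)) = 3"
    unfolding indicial_Q_op_at_infinity by simp
  ultimately show "regular_singular_point ?Q Infty"
    by (simp add: regular_singular_point_def deg)
  show "local_exponents ?Q Infty = {#1 + 2 * A2, 1 + A2 - A3, 1 + A2 + A3#}"
    unfolding local_exponents_def local_op.simps indicial_Q_op_at_infinity
    by (subst proots_smult, simp, subst proots_linear_product) (simp add: algebra_simps)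
qed

lemma local_op_Q_op_0: "local_op (Q_op A0 A1 A2 A3) (Fin 0) = Q_op A0 A1 A2 A3"
  by (simp add: map_poly_idI' pcompose_idR)

lemma pcompose_shift_1:
  fixes u v d e f g h k :: "'a :: comm_ring_1"
  shows "[:u, v:] \<circ>\<^sub>p [:1, 1:] = [:u + v, v:]"
    "[:d, e, f:] \<circ>\<^sub>p [:1, 1:] = [:d + e + f, e + 2 * f, f:]"
    "[:0, g, - 3 * g, 2 * g:] \<circ>\<^sub>p [:1, 1:] = [:0, g, 3 * g, 2 * g:]"
    "[:0, 0, 1, - 2, 1 :: 'a:] \<circ>\<^sub>p [:1, 1:] = [:0, 0, 1, 2, 1:]"
  by (simp_all add: pcompose_pCons algebra_simps)

text \<open>Besides the leading coefficient, only q2(1) and q1'(1) enter the indicial polynomial at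
  1, so the other entries stay existential. \<open>A0\<close> and \<open>A3\<close> cancel in
  q2(1).\<close>

lemma local_op_Q_op_1:
  "\<exists>u v d e f h k.
     local_op (Q_op A0 A1 A2 A3) (Fin 1) =
       [:[:u, v:], [:d, e, f:], [:0, 2 * A2 + 3, h, k:], [:0, 0, 1, 2, 1:]:] \<and>
     d = (A2 + 1)^2 - A1^2"
  unfolding Q_op_def local_op.simps
  by (simp only: map_poly_pCons pcompose_0 map_poly_0 pcompose_shift_1, intro exI conjI, rule refl)
     simp

lemma not_singular_Q_op:
  assumes "a \<noteq> 0" "a \<noteq> 1"
  shows "\<not> singular_point (Q_op A0 A1 A2 A3) (Fin a)"
proof -
  \<comment> \<open>In the coordinate x - a the leading coefficient has order 0, and no coefficient
    has a smaller order.\<close>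
  define p where "p = [:0, 0, 1, - 2, 1:] \<circ>\<^sub>p [:a, 1:]"
  have "poly p 0 = a^2 * (a - 1)^2"
    by (simp add: p_def poly_pcompose field_simps power2_eq_square)
  with assms have p: "poly p 0 \<noteq> 0" by simp
  then have "p \<noteq> 0" by auto
  moreover from p have "order 0 p = 0" by (rule order_0I)
  ultimately show ?thesis
    by (simp add: singular_point_def Q_op_def map_poly_pCons Let_def flip: p_def)
qed

lemma riemann_scheme_Q_op:
  assumes "2 * A2 + 3 \<noteq> 0" "2 * A2 + 1 \<noteq> 0" "A2 + 1 + A3 \<noteq> 0" "A2 + 1 - A3 \<noteq> 0"
  shows "has_riemann_scheme (Q_op A0 A1 A2 A3)
         {(Fin 0, {#0, - A0 - A2, A0 - A2#}),
          (Fin 1, {#0, - A1 - A2, A1 - A2#}),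
          (Infty, {#1 + 2 * A2, 1 + A2 - A3, 1 + A2 + A3#})}"
proof -
  let ?Q = "Q_op A0 A1 A2 A3"
  note at_0 = regular_singular_0[OF refl refl assms(1)
    local_op_Q_op_0[unfolded Q_op_def], folded Q_op_def]
  obtain u v d e f h k where
    "local_op ?Q (Fin 1) = [:[:u, v:], [:d, e, f:], [:0, 2 * A2 + 3, h, k:], [:0, 0, 1, 2, 1:]:]"
    "d = (A2 + 1)^2 - A1^2"
    using local_op_Q_op_1 by metis
  note at_1 = regular_singular_0[OF refl this(2) assms(1) this(1)]
  note at_infinity = regular_singular_Q_op_infinity[OF assms(2-4)]
  have "singular_point ?Q (Fin 0)" "singular_point ?Q (Fin 1)" "singular_point ?Q Infty"
    using at_0(1) at_1(1) at_infinity(1) by (simp_all only: regular_singular_point_def)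
  then have sing: "singular_point ?Q pt \<longleftrightarrow> pt \<in> {Fin 0, Fin 1, Infty}" for pt
    using not_singular_Q_op[of _ A0 A1 A2 A3] by (cases pt) blast+
  show ?thesis
    unfolding has_riemann_scheme_def sing
    using at_0 at_1 at_infinity by auto
qed

section \<open>Assembly and genericity\<close>

lemma mc_Z_tilde:
  assumes "2 * A2 - 1 \<noteq> 0" "A2 - 1 + A3 \<noteq> 0" "A2 - 1 - A3 \<noteq> 0"
  shows "mc (- 1/2 - A2) (Z_tilde A0 A1 A2 A3) = Q_op A0 A1 A2 A3"
proof (rule mc_eqI)
  show "Z_tilde A0 A1 A2 A3 \<noteq> 0" by (simp add: Z_tilde_eq)
  show "i \<le> j" if "(i, j) \<in> supp (Z_tilde A0 A1 A2 A3)" for i j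
    using subsetD[OF supp_Z_tilde that] by auto
  show "of_theta (map_poly (\<lambda>f. f \<circ>\<^sub>p [:-(- 1/2 - A2), 1:]) (to_theta (Z_tilde A0 A1 A2 A3)))
    = (lmul_d ^^ 1) (Q_op A0 A1 A2 A3)"
    using of_theta_shift by simp
qed (rule not_lmul_d_Q_op[OF assms])

lemma for_genericI:
  assumes "countable \<F>" "0 \<notin> \<F>"
    "\<And>a0 a1 a2 a3. (\<And>F. F \<in> \<F> \<Longrightarrow> poly4 F a0 a1 a2 a3 \<noteq> 0) \<Longrightarrow> \<Phi> a0 a1 a2 a3"
  shows "for_generic \<Phi>"
  unfolding for_generic_def using assms by (intro exI[of _ \<F>]) blast

lemma for_generic_affine:
  assumes "\<And>A0 A1 A2 A3. (\<And>a b c. (a, b, c) \<in> S \<Longrightarrow> a * A2 + b * A3 + c \<noteq> 0) \<Longrightarrow> \<Phi> A0 A1 A2 A3"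
    and "countable S" "(0, 0, 0) \<notin> S"
  shows "for_generic \<Phi>"
proof -
  \<comment> \<open>The outermost indeterminate is \<open>A3\<close>, so \<open>b\<close> is the
    coefficient of degree 1 there; \<open>a\<close> sits one level below, at
    \<open>A2\<close>.\<close>
  define F where "F = (\<lambda>(a, b, c). [:[:[:[:c:]:], [:[:a:]:]:], [:[:[:b:]:]:]:] :: complex poly poly poly poly)"
  have "poly4 (F (a, b, c)) A0 A1 A2 A3 = a * A2 + b * A3 + c" for a b c A0 A1 A2 A3
    by (simp add: F_def poly4_def algebra_simps)
  moreover have "0 \<notin> F ` S"
    using assms(3) by (auto simp: F_def)
  ultimately show ?thesis
    using assms(1,2) by (intro for_genericI[of "F ` S"]) (blast, assumption, metis imageI)
qed

theorem proposition6p2: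
  shows "for_generic (\<lambda>A0 A1 A2 A3.
    let q1 = smult (2 * A2 + 3) ((X - 1) * X * (2 * X - 1));
        q2 = smult (A0^2) X - [:A0^2:] - smult (A1^2) X
             + smult (5 * A2^2) (X^2) - smult (5 * A2^2) X + [:A2^2:]
             + smult (12 * A2) (X^2) - smult (12 * A2) X + [:2 * A2:]
             - smult (A3^2) (X^2) + smult (A3^2) X + 7 * X^2 - 7 * X + 1;
        q3 = smult (1/2 * (2 * A2 + 1))
             ([:A0^2:] - [:A1^2:] + smult (2 * A2^2) X - [:A2^2:] + smult (4 * A2) X
              - [:2 * A2:] - smult (2 * A3^2) X + [:A3^2:] + 2 * X - 1);
        Q = mc (- 1/2 - A2) (Z_tilde A0 A1 A2 A3)
    in Q = [:q3, q2, q1, X^2 * (X - 1)^2:] \<and>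
       degree Q = 3 \<and>
       has_riemann_scheme Q
         {(Fin 0, {#0, - A0 - A2, A0 - A2#}),
          (Fin 1, {#0, - A1 - A2, A1 - A2#}),
          (Infty, {#1 + 2 * A2, 1 + A2 - A3, 1 + A2 + A3#})})"
proof (rule for_generic_affine[where S =
    "{(2, 0, 3), (2, 0, 1), (2, 0, - 1), (1, 1, 1), (1, - 1, 1), (1, 1, - 1), (1, - 1, - 1)}"],
    goal_cases)
  case (1 A0 A1 A2 A3)
  \<comment> \<open>\<open>2 * A2 + 3\<close> makes 0 and 1 singular; \<open>2 * A2 + 1\<close> and
    \<open>A2 + 1 \<plusminus> A3\<close> do so for infinity. \<open>2 * A2 - 1\<close> and
    \<open>A2 - 1 \<plusminus> A3\<close> exclude a second division by \<partial>.\<close>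
  from 1[of 2 0 3] 1[of 2 0 1] 1[of 2 0 "- 1"] 1[of 1 1 1] 1[of 1 "- 1" 1]
    1[of 1 1 "- 1"] 1[of 1 "- 1" "- 1"]
  have nz: "2 * A2 + 3 \<noteq> 0" "2 * A2 + 1 \<noteq> 0" "2 * A2 - 1 \<noteq> 0" "A2 + 1 + A3 \<noteq> 0"
    "A2 + 1 - A3 \<noteq> 0" "A2 - 1 + A3 \<noteq> 0" "A2 - 1 - A3 \<noteq> 0"
    by (simp_all add: algebra_simps)
  show ?case
    unfolding Let_def mc_Z_tilde[OF nz(3,6,7)]
  proof (intro conjI riemann_scheme_Q_op nz, goal_cases)
    case 1
    show ?case
      \<comment> \<open>Complex polynomials agree if their functions do, which turns each
        coefficient into a ring identity in x and the parameters.\<close>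
      unfolding Q_op_def pCons_eq_iff
      by (intro conjI refl poly_eq_poly_eq_iff[THEN iffD1] ext; simp add: field_simps power2_eq_square)
  next
    case 2
    show ?case by (simp add: Q_op_def)
  qed
qed auto

end
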